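(* Let $C$ be the Cantor fan. (1) There is a continuous mapping $f:C\to C$, which is not a homeomorphism, such that $(C,f)$ is mixing as well as chaotic in the sense of Robinson but not in the sense of Devaney. (2) There is a homeomorphism $h:C\to C$ such that $(C,h)$ is mixing as well as chaotic in the sense of Robinson but not in the sense of Devaney.
   Context: The Cantor fan is (up to homeomorphism) the continuum $\bigcup_{c\in K}S_c$ in the plane, where $K\subseteq[0,1]$ is the standard Cantor set and $S_c$ is the straight line segment from $(0,0)$ to $(c,1)$. A dynamical system $(X,f)$ is a non-empty compact metric space $(X,d)$ with a continuous $f:X\to X$. It is transitive if for all non-empty open sets $U,V$ in $X$ there is a non-negative integer $n$ with $f^n(U)\cap V\neq\emptyset$. It is mixing if for all non-empty open sets $U,V$ in $X$ there is a non-negative integer $n_0$ such that $f^n(U)\cap V\neq\emptyset$ for each positive integer $n\geq n_0$. It has sensitive dependence on initial conditions if there is $\varepsilon>0$ such that for each $x\in X$ and each $\delta>0$ there are $y\in B(x,\delta)$ and a positive integer $n$ with $d(f^n(x),f^n(y))>\varepsilon$, where $B(x,\delta)$ is the open ball. A point $p\in X$ is periodic if $f^n(p)=p$ for some positive integer $n$; $\mathcal P(f)$ is the set of periodic points. $(X,f)$ is chaotic in the sense of Robinson if it is transitive and has sensitive dependence on initial conditions; it is chaotic in the sense of Devaney if it is transitive and $\mathcal P(f)$ is dense in $X$. *)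

theory Defs
  imports "HOL-Analysis.Analysis"
begin

primrec cantor_level :: "nat \<Rightarrow> real set" where
  "cantor_level 0 = {0..1}"
| "cantor_level (Suc n) =
     (\<lambda>x. x / 3) ` cantor_level n \<union> (\<lambda>x. 2 / 3 + x / 3) ` cantor_level n"

definition cantor_set :: "real set" where
  "cantor_set = (\<Inter>n. cantor_level n)"

definition standard_cantor_fan :: "(real \<times> real) set" where
  "standard_cantor_fan = (\<Union>c\<in>cantor_set. closed_segment (0, 0) (c, 1))"

definition is_cantor_fan :: "'a::metric_space set \<Rightarrow> bool" where
  "is_cantor_fan C \<longleftrightarrow> C homeomorphic standard_cantor_fan"

text \<open>
  A dynamical system lives on a subset \<open>X\<close> of a metric space type, with the metric
  and topology inherited from the type; the values of \<open>f\<close> outside \<open>X\<close> are irrelevant.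
\<close>

definition dynamical_system :: "'a::metric_space set \<Rightarrow> ('a \<Rightarrow> 'a) \<Rightarrow> bool" where
  "dynamical_system X f \<longleftrightarrow> X \<noteq> {} \<and> compact X \<and> continuous_on X f \<and> f ` X \<subseteq> X"

definition transitive_system :: "'a::metric_space set \<Rightarrow> ('a \<Rightarrow> 'a) \<Rightarrow> bool" where
  "transitive_system X f \<longleftrightarrow>
     (\<forall>U V. openin (top_of_set X) U \<and> U \<noteq> {} \<and> openin (top_of_set X) V \<and> V \<noteq> {} \<longrightarrow>
        (\<exists>n. (f ^^ n) ` U \<inter> V \<noteq> {}))"

definition mixing_system :: "'a::metric_space set \<Rightarrow> ('a \<Rightarrow> 'a) \<Rightarrow> bool" where
  "mixing_system X f \<longleftrightarrow>
     (\<forall>U V. openin (top_of_set X) U \<and> U \<noteq> {} \<and> openin (top_of_set X) V \<and> V \<noteq> {} \<longrightarrow>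
        (\<exists>n0. \<forall>n>0. n \<ge> n0 \<longrightarrow> (f ^^ n) ` U \<inter> V \<noteq> {}))"

definition sensitive_dependence :: "'a::metric_space set \<Rightarrow> ('a \<Rightarrow> 'a) \<Rightarrow> bool" where
  "sensitive_dependence X f \<longleftrightarrow>
     (\<exists>\<epsilon>>0. \<forall>x\<in>X. \<forall>\<delta>>0. \<exists>y \<in> ball x \<delta> \<inter> X. \<exists>n>0. dist ((f ^^ n) x) ((f ^^ n) y) > \<epsilon>)"

definition periodic_points :: "'a set \<Rightarrow> ('a \<Rightarrow> 'a) \<Rightarrow> 'a set" where
  "periodic_points X f = {p \<in> X. \<exists>n>0. (f ^^ n) p = p}"

definition robinson_chaotic :: "'a::metric_space set \<Rightarrow> ('a \<Rightarrow> 'a) \<Rightarrow> bool" where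
  "robinson_chaotic X f \<longleftrightarrow> transitive_system X f \<and> sensitive_dependence X f"

definition devaney_chaotic :: "'a::metric_space set \<Rightarrow> ('a \<Rightarrow> 'a) \<Rightarrow> bool" where
  "devaney_chaotic X f \<longleftrightarrow> transitive_system X f \<and> X \<subseteq> closure (periodic_points X f)"

end

theory Submission
  imports Defs
begin

text \<open>
  The Cantor fan is the cone over the Cantor set, and the Cantor set is homeomorphic to the space of
  families of bits indexed by any countably infinite set. So points of the fan are described
  by a family \<open>s\<close> of bits and a height \<open>t\<close> in \<open>[0, 1]\<close>, with all points of height \<open>0\<close> identified. Both
  maps are skew products
    \<open>(s, t) \<mapsto> (\<sigma> s, t powr exp (a s))\<close>,
  where \<open>\<sigma>\<close> is a shift on four symbols and \<open>a s\<close>, which depends on the current symbol only, takes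
  the values \<open>0\<close>, \<open>1\<close> and \<open>- \<surd>2\<close>. The one-sided shift gives a map that is not injective, the two-sided
  shift a homeomorphism.

  In the coordinate \<open>ln (- ln t)\<close> the action on heights is the translation by \<open>a s\<close>, so everything depends
  on the Birkhoff sums of \<open>a\<close>. These are the numbers \<open>j - k\<surd>2\<close>, and two facts about them
  carry the proof. First, with natural \<open>j\<close> and \<open>k\<close> they are dense in the reals; so an orbit can be steered
  between any two heights, and inserting symbols of value \<open>0\<close> allows any sufficiently long
  transition time. This gives mixing (\<open>cocycle_mixing_two_sided\<close>, \<open>mixing_fan_map\<close>), from which
  transitivity and sensitive dependence follow. Secondly, \<open>j - k\<surd>2\<close> vanishes only for \<open>j = k = 0\<close>; so a
  periodic point at an intermediate height sees symbols of value \<open>0\<close> only, and the periodic points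
  are not dense (\<open>not_devaney_chaotic_fan_map\<close>).
\<close>

section \<open>Spaces of bit families\<close>

lemma compact_UNIV_bool_functions: "compact (UNIV :: ('i \<Rightarrow> bool) set)"
proof -
  have "compact_space (euclidean :: bool topology)"
    by (simp add: compact_space_def finite_imp_compact)
  then have "compact_space (product_topology (\<lambda>i::'i. euclidean :: bool topology) UNIV)"
    by (simp add: compact_space_product_topology)
  then show ?thesis
    by (simp add: euclidean_product_topology compact_space_def)
qed

lemma continuous_on_coordinate: "continuous_on S (\<lambda>s::'k \<Rightarrow> bool. s k)"
  by (rule continuous_on_product_then_coordinatewise) (rule continuous_on_id)

text \<open>
  Basic open sets of the product topology restrict only finitely many coordinates. This is what
  leaves room to prescribe the remaining coordinates freely in the proof of mixing.
\<close>

lemma open_bool_functions_finite_support: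
  fixes s :: "'k \<Rightarrow> bool"
  assumes "open U" "s \<in> U"
  obtains A where "finite A" "\<And>s'. (\<forall>k\<in>A. s' k = s k) \<Longrightarrow> s' \<in> U"
proof -
  have "openin (product_topology (\<lambda>i. euclidean) UNIV) U"
    using assms(1) by (simp add: open_fun_def)
  from product_topology_open_contains_basis[OF this assms(2)]
  obtain X where X: "s \<in> (\<Pi>\<^sub>E i\<in>UNIV. X i)" "finite {i. X i \<noteq> UNIV}"
      "(\<Pi>\<^sub>E i\<in>UNIV. X i) \<subseteq> U"
    by auto
  show thesis
  proof (rule that[OF X(2)])
    fix s' assume eq: "\<forall>k\<in>{i. X i \<noteq> UNIV}. s' k = s k"
    have "s' k \<in> X k" for k
      using eq X(1) by (cases "X k = UNIV") (auto simp: PiE_iff)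
    then show "s' \<in> U"
      using X(3) by auto
  qed
qed

section \<open>The Cantor set and charts of the Cantor fan\<close>

text \<open>
  The usual parametrisation of the Cantor set by bit sequences: the bits \<open>0\<close> and \<open>1\<close> become the
  ternary digits \<open>0\<close> and \<open>2\<close>. All its properties come from the self-similarity
  \<open>cantor_code_unfold\<close> below, which matches the recursion defining \<open>cantor_level\<close>.
\<close>

definition cantor_code :: "(nat \<Rightarrow> bool) \<Rightarrow> real" where
  "cantor_code b = (\<Sum>n. 2 * of_bool (b n) / 3 ^ Suc n)"

lemma summable_cantor_code: "summable (\<lambda>n. 2 * of_bool (b n) / 3 ^ Suc n :: real)"
proof (rule summable_comparison_test')
  show "summable (\<lambda>n. 2 / 3 * (1 / 3) ^ n :: real)"
    by (intro summable_mult summable_geometric) auto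
  show "norm (2 * of_bool (b n) / 3 ^ Suc n :: real) \<le> 2 / 3 * (1 / 3) ^ n" for n
    by (auto simp: field_simps)
qed

lemma cantor_code_unfold:
  "cantor_code b = 2 / 3 * of_bool (b 0) + cantor_code (\<lambda>n. b (Suc n)) / 3"
proof -
  have "cantor_code b = 2 / 3 * of_bool (b 0) + (\<Sum>n. 2 * of_bool (b (Suc n)) / 3 ^ Suc (Suc n))"
    unfolding cantor_code_def using suminf_split_head[OF summable_cantor_code[of b]] by simp
  also have "(\<lambda>n. 2 * of_bool (b (Suc n)) / 3 ^ Suc (Suc n) :: real) =
      (\<lambda>n. 2 * of_bool (b (Suc n)) / 3 ^ Suc n / 3)"
    by (simp add: fun_eq_iff)
  also have "(\<Sum>n. 2 * of_bool (b (Suc n)) / 3 ^ Suc n / 3 :: real) = cantor_code (\<lambda>n. b (Suc n)) / 3"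
    unfolding cantor_code_def by (rule suminf_divide[OF summable_cantor_code])
  finally show ?thesis .
qed

lemma cantor_code_bounds: "0 \<le> cantor_code b" "cantor_code b \<le> 1"
proof -
  show "0 \<le> cantor_code b"
    unfolding cantor_code_def by (rule suminf_nonneg[OF summable_cantor_code]) simp
  have "cantor_code b \<le> (\<Sum>n. 2 / 3 * (1 / 3) ^ n)"
    unfolding cantor_code_def
    by (intro suminf_le summable_cantor_code summable_mult summable_geometric)
       (auto simp: field_simps)
  also have "\<dots> = 1"
    by (subst suminf_mult) (auto simp: suminf_geometric)
  finally show "cantor_code b \<le> 1" .
qed

lemma cantor_code_in_cantor_set: "cantor_code b \<in> cantor_set"
proof -
  have "cantor_code b \<in> cantor_level n" for n
  proof (induction n arbitrary: b)
    case 0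
    show ?case using cantor_code_bounds by simp
  next
    case (Suc n)
    show ?case
      using Suc[of "\<lambda>n. b (Suc n)"] cantor_code_unfold[of b] by (cases "b 0") auto
  qed
  then show ?thesis by (simp add: cantor_set_def)
qed

text \<open>
  The leading bit can be read off from the code, because the codes with leading bit \<open>0\<close> lie in
  \<open>[0, 1/3]\<close> and those with leading bit \<open>1\<close> in \<open>[2/3, 1]\<close>; the tails then have equal codes too.
\<close>

lemma inj_cantor_code: "inj cantor_code"
proof (rule injI)
  have head: "b 0 = b' 0 \<and> cantor_code (\<lambda>n. b (Suc n)) = cantor_code (\<lambda>n. b' (Suc n))"
    if "cantor_code b = cantor_code b'" for b b'
    using that cantor_code_unfold[of b] cantor_code_unfold[of b']
      cantor_code_bounds[of "\<lambda>n. b (Suc n)"] cantor_code_bounds[of "\<lambda>n. b' (Suc n)"]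
    by (cases "b 0"; cases "b' 0") auto
  fix b b' assume eq: "cantor_code b = cantor_code b'"
  have "b n = b' n" for n
    using eq
  proof (induction n arbitrary: b b')
    case 0
    then show ?case using head by blast
  next
    case (Suc n)
    show ?case by (rule Suc.IH) (use head[OF Suc.prems] in blast)
  qed
  then show "b = b'" by blast
qed

text \<open>
  The expanding map of the Cantor set, tripling modulo \<open>2\<close>, under which the code of a sequence goes
  to the code of its tail. Iterating it extracts the digits of a point.
\<close>

definition cantor_expand :: "real \<Rightarrow> real" where
  "cantor_expand x = 3 * x - 2 * of_bool (x > 1 / 2)"

lemma cantor_expand_in_cantor_set:
  assumes "x \<in> cantor_set"
  shows "cantor_expand x \<in> cantor_set"
proof -
  have unit: "cantor_level n \<subseteq> {0..1}" for n
    by (induction n) auto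
  have "cantor_expand x \<in> cantor_level n" for n
  proof -
    have "x \<in> cantor_level (Suc n)"
      using assms by (auto simp: cantor_set_def simp del: cantor_level.simps)
    then obtain y where y: "y \<in> cantor_level n" "x = y / 3 \<or> x = 2 / 3 + y / 3"
      by auto
    moreover have "0 \<le> y \<and> y \<le> 1"
      using y(1) unit[of n] by auto
    ultimately show ?thesis
      by (auto simp: cantor_expand_def mult.commute)
  qed
  then show ?thesis by (simp add: cantor_set_def)
qed

text \<open>
  For a point of the Cantor set, the code of its extracted digits and the point itself have the same
  leading digit, so \<open>cantor_expand\<close> triples their distance. As all points involved lie in the unit
  interval, the distance is at most \<open>3\<^sup>-\<^sup>n\<close> for every \<open>n\<close>, hence zero.
\<close>

lemma range_cantor_code: "range cantor_code = cantor_set"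
proof
  show "range cantor_code \<subseteq> cantor_set"
    using cantor_code_in_cantor_set by blast
  define digits where "digits x n = ((cantor_expand ^^ n) x > 1 / 2)" for x n
  have digits_Suc: "(\<lambda>n. digits x (Suc n)) = digits (cantor_expand x)" for x
    by (simp add: digits_def fun_eq_iff funpow_swap1)
  have approx: "\<bar>cantor_code (digits x) - x\<bar> \<le> (1 / 3) ^ n" if "x \<in> cantor_set" for x n
    using that
  proof (induction n arbitrary: x)
    case 0
    have "x \<in> cantor_level 0"
      using 0 unfolding cantor_set_def by blast
    then show ?case
      using cantor_code_bounds[of "digits x"] by auto
  next
    case (Suc n)
    have eq: "cantor_code (digits x) - x = (cantor_code (digits (cantor_expand x)) - cantor_expand x) / 3"
    proof -
      have "digits x 0 = (x > 1 / 2)"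
        by (simp add: digits_def)
      then show ?thesis
        using cantor_code_unfold[of "digits x"]
        by (simp add: digits_Suc) (simp add: cantor_expand_def diff_divide_distrib)
    qed
    show ?case
      unfolding eq using Suc.IH[OF cantor_expand_in_cantor_set[OF Suc.prems]] by simp
  qed
  show "cantor_set \<subseteq> range cantor_code"
  proof
    fix x assume x: "x \<in> cantor_set"
    have "(\<lambda>n. (1 / 3 :: real) ^ n) \<longlonglongrightarrow> 0"
      by (rule LIMSEQ_realpow_zero) auto
    then have "\<bar>cantor_code (digits x) - x\<bar> \<le> 0"
      by (rule LIMSEQ_le_const) (use approx[OF x] in blast)
    then show "x \<in> range cantor_code"
      by (metis abs_le_zero_iff eq_iff_diff_eq_0 rangeI)
  qed
qed

lemma continuous_cantor_code: "continuous_on UNIV cantor_code"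
proof (rule uniform_limit_theorem)
  show "uniform_limit UNIV (\<lambda>N b. \<Sum>n<N. 2 * of_bool (b n) / 3 ^ Suc n) cantor_code sequentially"
    unfolding cantor_code_def
  proof (rule Weierstrass_m_test)
    show "norm (2 * of_bool (b n) / 3 ^ Suc n :: real) \<le> 2 / 3 * (1 / 3) ^ n" for b n
      by (auto simp: field_simps)
    show "summable (\<lambda>n. 2 / 3 * (1 / 3) ^ n :: real)"
      by (intro summable_mult summable_geometric) auto
  qed
  have *: "continuous_on UNIV (\<lambda>b::nat \<Rightarrow> bool. of_bool (b n) :: real)" for n
    using continuous_on_compose2[of UNIV "of_bool :: bool \<Rightarrow> real" UNIV "\<lambda>b. b n"]
      continuous_on_coordinate[of UNIV n] by simp
  show "\<forall>\<^sub>F N in sequentially. continuous_on UNIV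
      (\<lambda>b::nat \<Rightarrow> bool. \<Sum>n<N. 2 * of_bool (b n) / 3 ^ Suc n :: real)"
    by (intro always_eventually allI continuous_on_sum continuous_on_divide continuous_on_mult
        continuous_on_const *) auto
qed auto

text \<open>
  A chart presents \<open>C\<close> as the cone over the space of base points \<open>s\<close>: the parameter \<open>t\<close> is the height
  above the apex, and the last clause says that exactly the level \<open>t = 0\<close> is collapsed to a point.
\<close>

definition fan_chart :: "('s::topological_space \<times> real \<Rightarrow> 'a::metric_space) \<Rightarrow> 'a set \<Rightarrow> bool" where
  "fan_chart \<pi> C \<longleftrightarrow>
     continuous_on (UNIV \<times> {0..1}) \<pi> \<and> \<pi> ` (UNIV \<times> {0..1}) = C \<and>
     (\<forall>s s'. \<forall>t\<in>{0..1}. \<forall>t'\<in>{0..1}. \<pi> (s, t) = \<pi> (s', t') \<longleftrightarrow> t = t' \<and> (t = 0 \<or> s = s'))"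

lemma standard_cantor_fan_eq: "standard_cantor_fan = (\<lambda>(b, t). (t * cantor_code b, t)) ` (UNIV \<times> {0..1})"
  unfolding standard_cantor_fan_def range_cantor_code[symmetric] closed_segment_def
  by (auto simp: image_iff)

text \<open>
  Any countably infinite set may index the bits, since it is in bijection with the natural numbers
  and the bijection only permutes the factors of the product. This freedom lets a single
  construction serve both for one-sided and for two-sided sequences.
\<close>

lemma cantor_fan_has_chart:
  fixes C :: "'a::metric_space set"
  assumes "is_cantor_fan C" "infinite (UNIV :: 'k set)" "countable (UNIV :: 'k set)"
  obtains \<pi> :: "('k \<Rightarrow> bool) \<times> real \<Rightarrow> 'a" where "fan_chart \<pi> C"
proof -
  obtain g f where "homeomorphism C standard_cantor_fan g f"
    using assms(1) by (auto simp: is_cantor_fan_def homeomorphic_def)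
  then have f: "continuous_on standard_cantor_fan f" "f ` standard_cantor_fan = C"
      "inj_on f standard_cantor_fan"
    by (auto simp: homeomorphism_def intro: inj_on_inverseI)
  obtain e :: "nat \<Rightarrow> 'k" where e: "bij e"
    using bij_betw_from_nat_into[OF assms(3,2)] by blast
  define q where "q = (\<lambda>(s, t). (t * cantor_code (s \<circ> e), t))"
  have image_q: "q ` (UNIV \<times> {0..1}) = standard_cantor_fan"
  proof -
    have "(b, t) \<in> (\<lambda>(s, t). (s \<circ> e, t)) ` (UNIV \<times> {0..1})"
      if "t \<in> {0..1}" for b :: "nat \<Rightarrow> bool" and t :: real
      using that e by (intro image_eqI[of _ _ "(b \<circ> inv e, t)"])
        (auto simp: fun_eq_iff bij_is_inj)
    then have "(\<lambda>(s :: 'k \<Rightarrow> bool, t). (s \<circ> e, t)) ` (UNIV \<times> {0..1}) = (UNIV \<times> {0..1::real})"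
      by (intro equalityI subsetI) auto
    moreover have "q = (\<lambda>(b, t). (t * cantor_code b, t)) \<circ> (\<lambda>(s, t). (s \<circ> e, t))"
      by (auto simp: q_def)
    ultimately show ?thesis
      by (simp only: standard_cantor_fan_eq image_comp[symmetric])
  qed
  have cont_q: "continuous_on (UNIV \<times> {0..1}) q"
  proof -
    have "continuous_on (UNIV \<times> {0..1}) (\<lambda>p::('k \<Rightarrow> bool) \<times> real. fst p \<circ> e)"
      unfolding comp_def
      by (intro continuous_on_coordinatewise_then_product
          continuous_on_compose2[OF continuous_on_coordinate continuous_on_fst[OF continuous_on_id]]) auto
    then have "continuous_on (UNIV \<times> {0..1}) (\<lambda>p::('k \<Rightarrow> bool) \<times> real. cantor_code (fst p \<circ> e))"
      by (rule continuous_on_compose2[OF continuous_cantor_code]) auto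
    then show ?thesis
      unfolding q_def case_prod_beta by (intro continuous_intros)
  qed
  have comp_e: "s \<circ> e = s' \<circ> e \<longleftrightarrow> s = s'" for s s' :: "'k \<Rightarrow> bool"
    using bij_is_surj[OF e] by (auto simp: fun_eq_iff) (metis surjD)+
  have q_eq: "q (s, t) = q (s', t') \<longleftrightarrow> t = t' \<and> (t = 0 \<or> s = s')" for s s' t t'
    using comp_e[of s s'] by (auto simp: q_def inj_eq[OF inj_cantor_code])
  have "fan_chart (f \<circ> q) C"
    unfolding fan_chart_def
  proof (intro conjI allI ballI)
    show "continuous_on (UNIV \<times> {0..1}) (f \<circ> q)"
      using cont_q f(1) image_q by (intro continuous_on_compose) auto
    show "(f \<circ> q) ` (UNIV \<times> {0..1}) = C"
      using image_q f(2) by (simp only: image_comp[symmetric])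
    fix s s' :: "'k \<Rightarrow> bool" and t t' :: real
    assume "t \<in> {0..1}" "t' \<in> {0..1}"
    then have "q (s, t) \<in> standard_cantor_fan" "q (s', t') \<in> standard_cantor_fan"
      using image_q by blast+
    then show "(f \<circ> q) (s, t) = (f \<circ> q) (s', t') \<longleftrightarrow> t = t' \<and> (t = 0 \<or> s = s')"
      using f(3) by (simp add: inj_on_eq_iff q_eq)
  qed
  then show thesis by (rule that)
qed

section \<open>Consequences of mixing\<close>

lemma mixing_imp_transitive: 
  assumes "mixing_system X f"
  shows "transitive_system X f"
  unfolding transitive_system_def
proof (intro allI impI)
  fix U V assume "openin (top_of_set X) U \<and> U \<noteq> {} \<and> openin (top_of_set X) V \<and> V \<noteq> {}"
  then obtain n0 where "\<forall>n>0. n \<ge> n0 \<longrightarrow> (f ^^ n) ` U \<inter> V \<noteq> {}"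
    using assms unfolding mixing_system_def by metis
  then show "\<exists>n. (f ^^ n) ` U \<inter> V \<noteq> {}"
    by (metis le_Suc_eq order_refl zero_less_Suc)
qed

text \<open>
  A ball visits the neighbourhoods of two distinct points \<open>p\<close> and \<open>q\<close> at the same time \<open>n\<close>. Wherever
  the centre \<open>x\<close> is then, one of the two visiting points is far from it. In particular sensitivity
  follows from a topological property, so it does not depend on which metric \<open>C\<close> carries.
\<close>

lemma mixing_imp_sensitive:
  fixes X :: "'a::metric_space set"
  assumes mix: "mixing_system X f" and pq: "p \<in> X" "q \<in> X" "p \<noteq> q"
  shows "sensitive_dependence X f"
  unfolding sensitive_dependence_def
proof (intro exI conjI ballI allI impI)
  define \<epsilon> where "\<epsilon> = dist p q / 4"
  show "0 < \<epsilon>" using pq by (simp add: \<epsilon>_def)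
  fix x and \<delta> :: real assume x: "x \<in> X" "0 < \<delta>"
  have reach: "\<exists>n0. \<forall>n>0. n \<ge> n0 \<longrightarrow> (\<exists>y\<in>ball x \<delta> \<inter> X. (f ^^ n) y \<in> ball v \<epsilon>)" if "v \<in> X" for v
  proof -
    have "openin (top_of_set X) (X \<inter> ball x \<delta>)" "openin (top_of_set X) (X \<inter> ball v \<epsilon>)"
      by (auto intro: openin_open_Int)
    moreover have "X \<inter> ball x \<delta> \<noteq> {}" "X \<inter> ball v \<epsilon> \<noteq> {}"
      using x that \<open>0 < \<epsilon>\<close> by auto
    ultimately obtain n0 where n0: "\<And>n. n > 0 \<Longrightarrow> n \<ge> n0 \<Longrightarrow>
        (f ^^ n) ` (X \<inter> ball x \<delta>) \<inter> (X \<inter> ball v \<epsilon>) \<noteq> {}"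
      using mix unfolding mixing_system_def by metis
    show ?thesis
    proof (intro exI allI impI)
      fix n assume "0 < n" "n0 \<le> n"
      with n0[of n] show "\<exists>y\<in>ball x \<delta> \<inter> X. (f ^^ n) y \<in> ball v \<epsilon>"
        by blast
    qed
  qed
  obtain n1 n2 where
      n1: "\<forall>n>0. n \<ge> n1 \<longrightarrow> (\<exists>y\<in>ball x \<delta> \<inter> X. (f ^^ n) y \<in> ball p \<epsilon>)" and
      n2: "\<forall>n>0. n \<ge> n2 \<longrightarrow> (\<exists>y\<in>ball x \<delta> \<inter> X. (f ^^ n) y \<in> ball q \<epsilon>)"
    using reach[OF pq(1)] reach[OF pq(2)] by blast
  define n where "n = Suc (max n1 n2)"
  have n_gt: "n > 0" "n \<ge> n1" "n \<ge> n2"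
    by (auto simp: n_def)
  obtain y where y: "y \<in> ball x \<delta> \<inter> X" "dist p ((f ^^ n) y) < \<epsilon>"
    using n1 n_gt unfolding mem_ball by blast
  obtain z where z: "z \<in> ball x \<delta> \<inter> X" "dist q ((f ^^ n) z) < \<epsilon>"
    using n2 n_gt unfolding mem_ball by blast
  have "dist p q \<le> dist p ((f ^^ n) y) + dist ((f ^^ n) x) ((f ^^ n) y)
      + dist ((f ^^ n) x) ((f ^^ n) z) + dist q ((f ^^ n) z)"
    using dist_triangle[of p q "(f ^^ n) y"] dist_triangle[of "(f ^^ n) y" q "(f ^^ n) x"]
      dist_triangle[of "(f ^^ n) x" q "(f ^^ n) z"]
    by (simp add: dist_commute)
  then have "dist ((f ^^ n) x) ((f ^^ n) y) > \<epsilon> \<or> dist ((f ^^ n) x) ((f ^^ n) z) > \<epsilon>"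
    using y(2) z(2) unfolding \<epsilon>_def by linarith
  then show "\<exists>y\<in>ball x \<delta> \<inter> X. \<exists>n>0. \<epsilon> < dist ((f ^^ n) x) ((f ^^ n) y)"
    using y(1) z(1) n_gt(1) by blast
qed

section \<open>Mixing cocycles\<close>

definition birkhoff_sum :: "('s \<Rightarrow> 's) \<Rightarrow> ('s \<Rightarrow> real) \<Rightarrow> nat \<Rightarrow> 's \<Rightarrow> real" where
  "birkhoff_sum \<sigma> a n s = (\<Sum>k<n. a ((\<sigma> ^^ k) s))"

text \<open>
  This is topological mixing of the map \<open>(s, w) \<mapsto> (\<sigma> s, w + a s)\<close> on the product of the base with the
  real line, with the translation invariance in the second coordinate used to start at \<open>w = 0\<close>.
\<close>

definition cocycle_mixing :: "('s::topological_space \<Rightarrow> 's) \<Rightarrow> ('s \<Rightarrow> real) \<Rightarrow> bool" where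
  "cocycle_mixing \<sigma> a \<longleftrightarrow>
     (\<forall>U V W. open U \<longrightarrow> U \<noteq> {} \<longrightarrow> open V \<longrightarrow> V \<noteq> {} \<longrightarrow> open W \<longrightarrow> W \<noteq> {} \<longrightarrow>
        (\<exists>n0. \<forall>n\<ge>n0. \<exists>s\<in>U. (\<sigma> ^^ n) s \<in> V \<and> birkhoff_sum \<sigma> a n s \<in> W))"

lemma cocycle_mixing_factor:
  assumes mix: "cocycle_mixing \<sigma> (a \<circ> \<rho>)" and cont: "continuous_on UNIV \<rho>" and "surj \<rho>"
    and semi: "\<And>s. \<rho> (\<sigma> s) = \<sigma>' (\<rho> s)"
  shows "cocycle_mixing \<sigma>' a"
  unfolding cocycle_mixing_def
proof (intro allI impI)
  fix U V :: "'b set" and W :: "real set"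
  assume U: "open U" "U \<noteq> {}" and V: "open V" "V \<noteq> {}" and W: "open W" "W \<noteq> {}"
  have iter: "\<rho> ((\<sigma> ^^ n) s) = (\<sigma>' ^^ n) (\<rho> s)" for n s
    by (induction n) (auto simp: semi)
  have "open (\<rho> -` U)" "open (\<rho> -` V)"
    using U(1) V(1) cont by (simp_all add: continuous_on_open_vimage)
  moreover have "\<rho> -` U \<noteq> {}" "\<rho> -` V \<noteq> {}"
    using U(2) V(2) \<open>surj \<rho>\<close> by (simp_all add: surj_vimage_empty)
  ultimately obtain n0 where n0: "\<forall>n\<ge>n0. \<exists>s\<in>\<rho> -` U. (\<sigma> ^^ n) s \<in> \<rho> -` V \<and> birkhoff_sum \<sigma> (a \<circ> \<rho>) n s \<in> W"
    using mix W unfolding cocycle_mixing_def by meson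
  have "birkhoff_sum \<sigma> (a \<circ> \<rho>) n s = birkhoff_sum \<sigma>' a n (\<rho> s)" for n s
    by (simp add: birkhoff_sum_def iter)
  with n0 show "\<exists>n0. \<forall>n\<ge>n0. \<exists>s\<in>U. (\<sigma>' ^^ n) s \<in> V \<and> birkhoff_sum \<sigma>' a n s \<in> W"
    by (metis iter vimageE)
qed

section \<open>Skew products on the fan\<close>

lemma powr_exp_unit: "t \<in> {0..1} \<Longrightarrow> t powr exp r \<in> {0..1::real}"
  by (auto intro: powr_le1)

text \<open>
  The system on the fan moves the fibre over \<open>s\<close> onto the fibre over \<open>\<sigma> s\<close> and acts on heights by the
  power \<open>exp (a s)\<close>. In the coordinate \<open>w = ln (- ln t)\<close> on the interior of a fibre, this action is the
  translation by \<open>a s\<close>; the apex \<open>t = 0\<close> is fixed, and the set of end points \<open>t = 1\<close> is invariant.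
\<close>

locale fan_skew_product =
  fixes C :: "'a::metric_space set" and \<pi> :: "('k \<Rightarrow> bool) \<times> real \<Rightarrow> 'a"
    and \<sigma> :: "('k \<Rightarrow> bool) \<Rightarrow> ('k \<Rightarrow> bool)" and a :: "('k \<Rightarrow> bool) \<Rightarrow> real" and F :: "'a \<Rightarrow> 'a"
  assumes chart: "fan_chart \<pi> C"
    and cont_\<sigma>: "continuous_on UNIV \<sigma>" and cont_a: "continuous_on UNIV a"
    and semiconj: "t \<in> {0..1} \<Longrightarrow> F (\<pi> (s, t)) = \<pi> (\<sigma> s, t powr exp (a s))"
begin

lemma cont_chart: "continuous_on (UNIV \<times> {0..1}) \<pi>"
  and image_chart: "\<pi> ` (UNIV \<times> {0..1}) = C"
  and chart_eq_iff: "t \<in> {0..1} \<Longrightarrow> t' \<in> {0..1} \<Longrightarrow>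
      \<pi> (s, t) = \<pi> (s', t') \<longleftrightarrow> t = t' \<and> (t = 0 \<or> s = s')"
  using chart unfolding fan_chart_def by blast+

lemma chart_in: "t \<in> {0..1} \<Longrightarrow> \<pi> (s, t) \<in> C"
  using image_chart by blast

lemma chart_cases:
  assumes "p \<in> C" obtains s t where "t \<in> {0..1}" "p = \<pi> (s, t)"
  using assms image_chart by fastforce

lemma compact_domain: "compact ((UNIV :: ('k \<Rightarrow> bool) set) \<times> {0..1::real})"
  by (intro compact_Times compact_UNIV_bool_functions compact_Icc)

lemma compact_fan: "compact C"
  using compact_continuous_image[OF cont_chart compact_domain] image_chart by simp

lemma maps_to_fan: "F ` C \<subseteq> C"
  by (auto elim!: chart_cases simp: semiconj intro!: chart_in powr_exp_unit)

text \<open>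
  The map is continuous in the coordinates \<open>(s, t)\<close>, also at \<open>t = 0\<close> because the exponents are positive.
  Continuity on \<open>C\<close> follows because a chart is a continuous surjection from a compact space onto a
  Hausdorff space, thus a quotient map.
\<close>

lemma continuous_fan_map: "continuous_on C F"
proof -
  have "continuous_on (UNIV \<times> {0..1}) (\<lambda>p. (\<sigma> (fst p), snd p powr exp (a (fst p))))"
  proof (intro continuous_on_Pair continuous_on_powr' continuous_on_exp ballI conjI impI)
    show "continuous_on (UNIV \<times> {0..1::real}) (\<lambda>p. \<sigma> (fst p))"
      by (rule continuous_on_compose2[OF cont_\<sigma> continuous_on_fst[OF continuous_on_id]]) auto
    show "continuous_on (UNIV \<times> {0..1::real}) (\<lambda>p. a (fst p))"
      by (rule continuous_on_compose2[OF cont_a continuous_on_fst[OF continuous_on_id]]) auto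
  qed (auto intro: continuous_intros)
  then have "continuous_on (UNIV \<times> {0..1}) (\<lambda>p. \<pi> (\<sigma> (fst p), snd p powr exp (a (fst p))))"
    by (rule continuous_on_compose2[OF cont_chart]) (use powr_exp_unit in auto)
  then have "continuous_on (UNIV \<times> {0..1}) (F \<circ> \<pi>)"
    by (rule continuous_on_eq) (auto simp: semiconj)
  then have comp: "continuous_map (top_of_set (UNIV \<times> {0..1})) euclidean (F \<circ> \<pi>)"
    by simp
  have "quotient_map (top_of_set (UNIV \<times> {0..1})) (top_of_set C) \<pi>"
    using cont_chart image_chart compact_domain
    by (intro T1_Spaces.continuous_imp_quotient_map)
      (auto simp: compact_space_subtopology Hausdorff_space_subtopology)
  then have "continuous_map (top_of_set C) euclidean F"
    using comp by (rule continuous_compose_quotient_map)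
  then show ?thesis by simp
qed

lemma dynamical_system_fan_map: "dynamical_system C F"
  unfolding dynamical_system_def
  using compact_fan continuous_fan_map maps_to_fan chart_in[of 0] by auto

lemma iterate:
  assumes "t \<in> {0..1}"
  shows "(F ^^ n) (\<pi> (s, t)) = \<pi> ((\<sigma> ^^ n) s, t powr exp (birkhoff_sum \<sigma> a n s))"
proof (induction n)
  case 0
  then show ?case using assms by (simp add: birkhoff_sum_def)
next
  case (Suc n)
  then show ?case
    using powr_exp_unit[OF assms] by (simp add: semiconj birkhoff_sum_def powr_powr exp_add)
qed

text \<open>
  Open sets of the fan meet the part with heights strictly between \<open>0\<close> and \<open>1\<close>, where the logarithmic
  coordinate is available.
\<close>

lemma open_box:
  assumes "openin (top_of_set C) U" "U \<noteq> {}"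
  obtains A I where "open A" "A \<noteq> {}" "open I" "I \<noteq> {}" "I \<subseteq> {0<..<1}"
    "\<And>s t. s \<in> A \<Longrightarrow> t \<in> I \<Longrightarrow> \<pi> (s, t) \<in> U"
proof -
  have "openin (top_of_set (UNIV \<times> {0..1})) ((UNIV \<times> {0..1}) \<inter> \<pi> -` U)"
    by (rule continuous_openin_preimage[OF cont_chart _ assms(1)]) (use image_chart in auto)
  then obtain W where W: "open W" "(UNIV \<times> {0..1}) \<inter> \<pi> -` U = (UNIV \<times> {0..1}) \<inter> W"
    by (auto simp: openin_open)
  obtain s t where st: "t \<in> {0..1}" "\<pi> (s, t) \<in> U"
    using assms openin_imp_subset chart_cases by (metis all_not_in_conv subsetD)
  then have "(s, t) \<in> W"
    using W(2) by blast
  with W(1) obtain A I where AI: "open A" "open I" "(s, t) \<in> A \<times> I" "A \<times> I \<subseteq> W"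
    by (rule open_prod_elim)
  have "t \<in> closure {0<..<1::real}"
    using st(1) by simp
  then have "I \<inter> {0<..<1} \<noteq> {}"
    using AI by (metis IntI SigmaD2 Int_commute disjoint_iff open_Int_closure_eq_empty)
  moreover have "\<pi> (s', t') \<in> U" if "s' \<in> A" "t' \<in> I \<inter> {0<..<1}" for s' t'
  proof -
    have "(s', t') \<in> (UNIV \<times> {0..1}) \<inter> W"
      using that AI(4) by auto
    then show ?thesis using W(2) by blast
  qed
  ultimately show thesis
    using AI by (intro that[of A "I \<inter> {0<..<1}"]) auto
qed

text \<open>
  Fix one height \<open>t\<close> in the first box. Reaching a height in the second one amounts to the Birkhoff sum
  lying in an open set \<open>W\<close> of reals, so the property of the cocycle applies.
\<close>

lemma mixing_fan_map:
  assumes "cocycle_mixing \<sigma> a"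
  shows "mixing_system C F"
  unfolding mixing_system_def
proof (intro allI impI)
  fix U V assume UV: "openin (top_of_set C) U \<and> U \<noteq> {} \<and> openin (top_of_set C) V \<and> V \<noteq> {}"
  obtain A I where A: "open A" "A \<noteq> {}" and I: "open I" "I \<noteq> {}" "I \<subseteq> {0<..<1}"
    and AI: "\<And>s t. s \<in> A \<Longrightarrow> t \<in> I \<Longrightarrow> \<pi> (s, t) \<in> U"
    using UV open_box by metis
  obtain B J where B: "open B" "B \<noteq> {}" and J: "open J" "J \<noteq> {}" "J \<subseteq> {0<..<1}"
    and BJ: "\<And>s t. s \<in> B \<Longrightarrow> t \<in> J \<Longrightarrow> \<pi> (s, t) \<in> V"
    using UV open_box by metis
  obtain t t' where t: "t \<in> I" "0 < t" "t < 1" and t': "t' \<in> J" "0 < t'" "t' < 1"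
    using I J by fastforce
  define W where "W = (\<lambda>w. t powr exp w) -` J"
  have "open W"
    unfolding W_def using J(1) t
    by (intro open_vimage continuous_on_powr continuous_intros) auto
  \<comment> \<open>this is the translation in the coordinate \<open>ln (- ln t)\<close> that moves \<open>t\<close> to \<open>t'\<close>\<close>
  moreover have "ln (ln t' / ln t) \<in> W"
  proof -
    have "ln t < 0" "ln t' < 0"
      using t t' by simp_all
    then have "exp (ln (ln t' / ln t)) = ln t' / ln t"
      by (simp add: zero_less_divide_iff)
    then have "t powr exp (ln (ln t' / ln t)) = t'"
      using t t' \<open>ln t < 0\<close> by (simp add: powr_def)
    then show ?thesis using t' by (simp add: W_def)
  qed
  ultimately obtain n0 where n0: "\<forall>n\<ge>n0. \<exists>s\<in>A. (\<sigma> ^^ n) s \<in> B \<and> birkhoff_sum \<sigma> a n s \<in> W"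
    using assms A B unfolding cocycle_mixing_def by (metis empty_iff)
  show "\<exists>n0. \<forall>n>0. n0 \<le> n \<longrightarrow> (F ^^ n) ` U \<inter> V \<noteq> {}"
  proof (intro exI allI impI)
    fix n assume "n0 \<le> n"
    then obtain s where s: "s \<in> A" "(\<sigma> ^^ n) s \<in> B" "birkhoff_sum \<sigma> a n s \<in> W"
      using n0 by blast
    then have "(F ^^ n) (\<pi> (s, t)) \<in> V"
      using t by (simp add: iterate) (simp add: BJ W_def)
    then show "(F ^^ n) ` U \<inter> V \<noteq> {}"
      using AI[OF s(1) t(1)] by blast
  qed
qed

lemma robinson_chaotic_fan_map:
  assumes "cocycle_mixing \<sigma> a"
  shows "robinson_chaotic C F"
proof -
  have mix: "mixing_system C F"
    by (rule mixing_fan_map[OF assms])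
  have "\<pi> (undefined, 0) \<noteq> \<pi> (undefined, 1)"
    by (simp add: chart_eq_iff)
  then show ?thesis
    unfolding robinson_chaotic_def
    using mixing_imp_transitive[OF mix] mixing_imp_sensitive[OF mix] chart_in
    by (metis atLeastAtMost_iff order_refl zero_le_one)
qed

text \<open>
  A periodic point at a height strictly between \<open>0\<close> and \<open>1\<close> returns to its height, so the Birkhoff sum
  of \<open>a\<close> over a period vanishes. If sums only vanish when \<open>a s = 0\<close>, all periodic points lie in
  a closed set \<open>\<pi> ` Z\<close>, which misses the interior of the fibre over any \<open>s1\<close> with \<open>a s1 \<noteq> 0\<close>.
\<close>

lemma not_devaney_chaotic_fan_map:
  assumes no_cancel: "\<And>n s. n > 0 \<Longrightarrow> birkhoff_sum \<sigma> a n s = 0 \<Longrightarrow> a s = 0"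
    and "a s1 \<noteq> 0"
  shows "\<not> devaney_chaotic C F"
proof
  assume "devaney_chaotic C F"
  define Z where "Z = (UNIV \<times> {0, 1}) \<union> ({s. a s = 0} \<times> {0..1::real})"
  have Z_sub: "Z \<subseteq> UNIV \<times> {0..1}"
    by (auto simp: Z_def)
  have "closed Z"
    unfolding Z_def using cont_a
    by (intro closed_Un closed_Times closed_Collect_eq) auto
  then have "compact Z"
    using compact_Int_closed[OF compact_domain, of Z] Z_sub by (simp add: Int_absorb1)
  then have "closed (\<pi> ` Z)"
    using compact_continuous_image continuous_on_subset[OF cont_chart Z_sub] compact_imp_closed by blast
  moreover have "periodic_points C F \<subseteq> \<pi> ` Z"
  proof
    fix p assume "p \<in> periodic_points C F"
    then obtain n where p: "p \<in> C" "n > 0" "(F ^^ n) p = p"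
      by (auto simp: periodic_points_def)
    obtain s t where st: "t \<in> {0..1}" "p = \<pi> (s, t)"
      using p(1) chart_cases by blast
    have "(s, t) \<in> Z"
    proof (cases "t = 0 \<or> t = 1")
      case False
      then have t: "0 < t" "t < 1"
        using st(1) by auto
      have "t powr exp (birkhoff_sum \<sigma> a n s) = t"
        using p(3) st powr_exp_unit[OF st(1)] by (simp add: iterate chart_eq_iff)
      then have "t powr exp (birkhoff_sum \<sigma> a n s) = t powr 1"
        using t by simp
      then have "birkhoff_sum \<sigma> a n s = 0"
        using t powr_inj[of t "exp (birkhoff_sum \<sigma> a n s)" 1] by simp
      then show ?thesis
        using no_cancel[OF p(2)] st(1) by (simp add: Z_def)
    qed (auto simp: Z_def)
    then show "p \<in> \<pi> ` Z"
      using st(2) by blast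
  qed
  ultimately have "C \<subseteq> \<pi> ` Z"
    using \<open>devaney_chaotic C F\<close> closure_minimal unfolding devaney_chaotic_def by blast
  then have "\<pi> (s1, 1 / 2) \<in> \<pi> ` Z"
    using chart_in[of "1 / 2"] by auto
  then obtain s t where "(s, t) \<in> Z" "\<pi> (s, t) = \<pi> (s1, 1 / 2)"
    by auto
  moreover from this Z_sub have "t \<in> {0..1}"
    by blast
  ultimately show False
    using assms(2) by (auto simp: chart_eq_iff Z_def)
qed

text \<open>
  On each fibre the map is a power, hence invertible; so the only obstruction to invertibility is in the
  base.
\<close>

lemma homeomorphism_fan_map:
  assumes "bij \<sigma>"
  shows "\<exists>g. homeomorphism C C F g"
proof (rule homeomorphism_compact[OF compact_fan continuous_fan_map])
  show "F ` C = C"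
  proof
    show "C \<subseteq> F ` C"
    proof
      fix p assume "p \<in> C"
      then obtain s t where st: "t \<in> {0..1}" "p = \<pi> (s, t)"
        by (rule chart_cases)
      obtain s' where s': "\<sigma> s' = s"
        using assms by (metis bij_pointE)
      have "p = F (\<pi> (s', t powr exp (- a s')))"
        using st s' powr_exp_unit[OF st(1)] by (simp add: semiconj powr_powr flip: exp_add)
      then show "p \<in> F ` C"
        using chart_in[OF powr_exp_unit[OF st(1)]] by blast
    qed
  qed (rule maps_to_fan)
  show "inj_on F C"
  proof (rule inj_onI)
    fix p q assume pq: "p \<in> C" "q \<in> C" "F p = F q"
    obtain s t where st: "t \<in> {0..1}" "p = \<pi> (s, t)"
      using pq(1) by (rule chart_cases)
    obtain s' t' where st': "t' \<in> {0..1}" "q = \<pi> (s', t')"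
      using pq(2) by (rule chart_cases)
    have eq: "t powr exp (a s) = t' powr exp (a s')" "t powr exp (a s) = 0 \<or> \<sigma> s = \<sigma> s'"
      using pq(3) st st' powr_exp_unit[OF st(1)] powr_exp_unit[OF st'(1)]
      by (auto simp: semiconj chart_eq_iff)
    show "p = q"
    proof (cases "t = 0")
      case True
      then show ?thesis using eq(1) st st' by (auto simp: chart_eq_iff)
    next
      case False
      then have "s = s'"
        using eq(2) assms by (simp add: bij_is_inj inj_eq)
      moreover have "(t powr exp (a s)) powr exp (- a s) = (t' powr exp (a s')) powr exp (- a s)"
        using eq(1) by simp
      ultimately have "t = t'"
        using st(1) st'(1) by (simp add: powr_powr flip: exp_add)
      with \<open>s = s'\<close> show ?thesis using st st' by simp
    qed
  qed
qed

text \<open>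
  Two base points with the same image give two end points of the fan with the same image, because
  \<open>1\<close> to any power is \<open>1\<close>.
\<close>

lemma not_homeomorphism_fan_map:
  assumes "\<not> inj \<sigma>"
  shows "\<not> (\<exists>g. homeomorphism C C F g)"
proof
  assume "\<exists>g. homeomorphism C C F g"
  then have inj: "inj_on F C"
    by (auto simp: homeomorphism_def intro: inj_on_inverseI)
  obtain s s' where "\<sigma> s = \<sigma> s'" "s \<noteq> s'"
    using assms by (auto simp: inj_def)
  then have "F (\<pi> (s, 1)) = F (\<pi> (s', 1))"
    by (simp add: semiconj)
  then have "\<pi> (s, 1) = \<pi> (s', 1)"
    using inj chart_in by (simp add: inj_on_eq_iff)
  with \<open>s \<noteq> s'\<close> show False
    by (simp add: chart_eq_iff)
qed

end

text \<open>
  The formula for the map descends from \<open>(s, t)\<close> to the fan because all points \<open>(s, 0)\<close> are sent to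
  points of height \<open>0\<close>, which the chart identifies.
\<close>

lemma fan_skew_product_exists:
  assumes "fan_chart \<pi> C" "continuous_on UNIV \<sigma>" "continuous_on UNIV a"
  obtains F where "fan_skew_product C \<pi> \<sigma> a F"
proof -
  define T where "T = (\<lambda>(s, t). \<pi> (\<sigma> s, t powr exp (a s)))"
  have "\<exists>q. \<forall>t\<in>{0..1}. \<forall>s. \<pi> (s, t) = p \<longrightarrow> T (s, t) = q" for p
  proof (cases "\<exists>s. \<exists>t\<in>{0..1}. \<pi> (s, t) = p")
    case True
    then obtain s t where st: "t \<in> {0..1}" "\<pi> (s, t) = p"
      by blast
    have "T (s', t') = T (s, t)" if "t' \<in> {0..1}" "\<pi> (s', t') = p" for s' t'
    proof -
      have "t' = t \<and> (t = 0 \<or> s' = s)"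
        using assms(1) st that unfolding fan_chart_def by metis
      moreover have "\<pi> (\<sigma> s', 0) = \<pi> (\<sigma> s, 0)"
        using assms(1) unfolding fan_chart_def by simp
      ultimately show ?thesis
        by (auto simp: T_def)
    qed
    then show ?thesis by blast
  qed blast
  then obtain F where "\<And>p s t. t \<in> {0..1} \<Longrightarrow> \<pi> (s, t) = p \<Longrightarrow> T (s, t) = F p"
    by metis
  then have "fan_skew_product C \<pi> \<sigma> a F"
    using assms by unfold_locales (auto simp: T_def)
  then show thesis by (rule that)
qed

section \<open>Combinations of 1 and the square root of 2\<close>

text \<open>
  The irrationality of \<open>\<surd>2\<close> by infinite descent: from \<open>j\<^sup>2 = 2 * k\<^sup>2\<close> one gets \<open>k\<^sup>2 = 2 * (j div 2)\<^sup>2\<close>.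
\<close>

lemma square_eq_double_square:
  fixes j k :: nat
  assumes "j\<^sup>2 = 2 * k\<^sup>2"
  shows "k = 0"
  using assms
proof (induction k arbitrary: j rule: less_induct)
  case (less k)
  have "even j"
    using less.prems by (metis dvd_triv_left even_power)
  then obtain m where m: "j = 2 * m" by blast
  then have km: "k\<^sup>2 = 2 * m\<^sup>2"
    using less.prems by (simp add: power_mult_distrib)
  show "k = 0"
  proof (rule ccontr)
    assume "k \<noteq> 0"
    then have "m\<^sup>2 < k\<^sup>2"
      using km by (cases "m = 0") auto
    then have "m < k"
      by (rule power_less_imp_less_base) simp
    then have "m = 0"
      using less.IH km by blast
    with km \<open>k \<noteq> 0\<close> show False by simp
  qed
qed

lemma nat_combination_sqrt2_eq_0:
  assumes "real j - sqrt 2 * real k = 0"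
  shows "j = 0" "k = 0"
proof -
  have "(real j)\<^sup>2 = (sqrt 2 * real k)\<^sup>2"
    using assms by simp
  then have "real (j\<^sup>2) = real (2 * k\<^sup>2)"
    by (simp add: power_mult_distrib)
  then have "j\<^sup>2 = 2 * k\<^sup>2"
    unfolding of_nat_eq_iff .
  then show "k = 0" by (rule square_eq_double_square)
  with assms show "j = 0" by simp
qed

text \<open>
  These powers are arbitrarily small and of alternating sign, while both coefficients remain
  natural numbers. Multiples of them therefore reach every open set of reals, positive or negative.
\<close>

lemma power_one_minus_sqrt2: "\<exists>j k. (1 - sqrt 2) ^ n = real j - sqrt 2 * real k"
proof (induction n)
  case 0
  show ?case by (rule exI[of _ 1], rule exI[of _ 0]) simp
next
  case (Suc n)
  then obtain j k where "(1 - sqrt 2) ^ n = real j - sqrt 2 * real k" by blast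
  then have "(1 - sqrt 2) ^ Suc n = (1 - sqrt 2) * (real j - sqrt 2 * real k)"
    by simp
  also have "\<dots> = real (j + 2 * k) - sqrt 2 * real (j + k)"
    by (simp add: algebra_simps)
  finally have "(1 - sqrt 2) ^ Suc n = real (j + 2 * k) - sqrt 2 * real (j + k)" .
  then show ?case by blast
qed

lemma nat_combinations_sqrt2_dense:
  fixes W :: "real set"
  assumes "open W" "W \<noteq> {}"
  obtains j k :: nat where "real j - sqrt 2 * real k \<in> W"
proof -
  obtain w \<epsilon> where w: "\<epsilon> > 0" "ball w \<epsilon> \<subseteq> W"
    using assms open_contains_ball by blast
  define r where "r = 1 - sqrt 2"
  have r: "-1 < r" "r < 0"
    using sqrt2_less_2 by (auto simp: r_def)
  then obtain n where n: "\<bar>r\<bar> ^ n < \<epsilon>"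
    using real_arch_pow_inv[OF w(1), of "\<bar>r\<bar>"] by auto
  \<comment> \<open>an even power is positive, an odd one negative: take the sign of \<open>w\<close>\<close>
  define N where "N = (if w \<ge> 0 then 2 * n else Suc (2 * n))"
  define d where "d = r ^ N"
  have "\<bar>d\<bar> \<le> \<bar>r\<bar> ^ n"
    unfolding d_def power_abs using r by (intro power_decreasing) (auto simp: N_def)
  then have d_small: "\<bar>d\<bar> < \<epsilon>"
    using n by simp
  have d_sign: "d \<noteq> 0" "w / d \<ge> 0"
    using r by (auto simp: d_def N_def power_mult zero_le_divide_iff mult_le_0_iff)
  define m where "m = nat \<lfloor>w / d\<rfloor>"
  have "\<bar>w / d - real m\<bar> < 1"
    using d_sign(2) unfolding m_def by linarith
  then have "\<bar>w / d - real m\<bar> * \<bar>d\<bar> < 1 * \<bar>d\<bar>"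
    using d_sign(1) by (intro mult_strict_right_mono) auto
  then have "\<bar>w - real m * d\<bar> < \<epsilon>"
    using d_sign(1) d_small by (simp add: left_diff_distrib flip: abs_mult)
  then have "real m * d \<in> W"
    using w(2) by (auto simp: dist_real_def)
  moreover obtain j k where "d = real j - sqrt 2 * real k"
    using power_one_minus_sqrt2 unfolding d_def r_def by blast
  ultimately have "real (m * j) - sqrt 2 * real (m * k) \<in> W"
    by (simp add: algebra_simps)
  then show thesis by (rule that)
qed

section \<open>The shift and its cocycle\<close>

text \<open>
  A point of the base carries two bits at each time \<open>i\<close>, hence a sequence over an alphabet of four
  symbols. Times range over \<open>nat\<close> for the one-sided shift and over \<open>int\<close> for the two-sided one.
\<close>

definition time_shift :: "('i::semiring_1 \<times> bool \<Rightarrow> bool) \<Rightarrow> ('i \<times> bool \<Rightarrow> bool)" where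
  "time_shift s = (\<lambda>(i, b). s (i + 1, b))"

text \<open>
  The two symbols with first bit \<open>False\<close> have value \<open>0\<close>, the other two have the values \<open>1\<close> and
  \<open>- \<surd>2\<close>. The cocycle is \<open>step_at 0\<close>, the value of the symbol at time \<open>0\<close>; its Birkhoff sums add up the
  values at successive times.
\<close>

definition step_at :: "'i \<Rightarrow> ('i \<times> bool \<Rightarrow> bool) \<Rightarrow> real" where
  "step_at i s = of_bool (s (i, False)) * (if s (i, True) then 1 else - sqrt 2)"

lemma continuous_time_shift: "continuous_on UNIV time_shift"
  unfolding time_shift_def
  by (intro continuous_on_coordinatewise_then_product) (auto simp: case_prod_beta continuous_on_coordinate)

lemma continuous_step_at: "continuous_on UNIV (step_at i)"
proof -
  have "continuous_on UNIV (\<lambda>s. f (s (i, b)))" for f :: "bool \<Rightarrow> real" and b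
    using continuous_on_compose2[of UNIV f UNIV "\<lambda>s. s (i, b)"] continuous_on_coordinate[of UNIV "(i, b)"]
    by simp
  then show ?thesis
    unfolding step_at_def by (intro continuous_on_mult)
qed

lemma funpow_time_shift: "(time_shift ^^ n) s = (\<lambda>(i, b). s (i + of_nat n, b))"
  by (induction n) (auto simp: time_shift_def fun_eq_iff add_ac)

lemma birkhoff_sum_time_shift:
  "birkhoff_sum time_shift (step_at 0) n s = (\<Sum>k<n. step_at (of_nat k) s)"
  by (simp add: birkhoff_sum_def step_at_def funpow_time_shift)

text \<open>
  A Birkhoff sum is \<open>j - k\<surd>2\<close>, where \<open>j\<close> and \<open>k\<close> count the symbols of value \<open>1\<close> and \<open>- \<surd>2\<close>. By
  irrationality it vanishes only if neither of them occurs.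
\<close>

lemma birkhoff_sum_time_shift_eq_0:
  assumes "0 < n" "birkhoff_sum time_shift (step_at 0) n s = 0"
  shows "step_at 0 s = 0"
proof -
  define A where "A = {k\<in>{..<n}. s (of_nat k, False) \<and> s (of_nat k, True)}"
  define B where "B = {k\<in>{..<n}. s (of_nat k, False) \<and> \<not> s (of_nat k, True)}"
  have "step_at (of_nat k) s = of_bool (k \<in> A) - sqrt 2 * of_bool (k \<in> B)" if "k < n" for k
    using that by (auto simp: step_at_def A_def B_def)
  then have "birkhoff_sum time_shift (step_at 0) n s =
      (\<Sum>k<n. of_bool (k \<in> A)) - sqrt 2 * (\<Sum>k<n. of_bool (k \<in> B))"
    by (simp add: birkhoff_sum_time_shift sum_subtractf sum_distrib_left)
  also have "\<dots> = real (card A) - sqrt 2 * real (card B)"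
    by (simp add: sum.If_cases of_bool_def A_def B_def Int_def)
  finally have "real (card A) - sqrt 2 * real (card B) = 0"
    using assms(2) by simp
  then have "card A = 0" "card B = 0"
    by (rule nat_combination_sqrt2_eq_0)+
  moreover have "finite A" "finite B"
    by (simp_all add: A_def B_def)
  ultimately have "0 \<notin> A" "0 \<notin> B"
    by simp_all
  then show ?thesis
    using assms(1) by (auto simp: A_def B_def step_at_def)
qed

lemma sum_lessThan_add: "(\<Sum>i<p + q. f i) = (\<Sum>i<p. f i) + (\<Sum>i<q. f (p + i :: nat))"
  for f :: "nat \<Rightarrow> real"
  by (induction q) (simp_all add: add.assoc)

text \<open>
  Given base points \<open>u\<close> and \<open>v\<close> in the two open sets, follow \<open>u\<close> up to time \<open>m\<close> and \<open>v\<close>, shifted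
  by \<open>n\<close>, from time \<open>n - m\<close> on, where \<open>m\<close> bounds the finitely many coordinates that matter. In between
  put \<open>j\<close> symbols of value \<open>1\<close> and \<open>k\<close> of value \<open>- \<surd>2\<close>, chosen by density to bring the Birkhoff sum into
  \<open>W\<close>, and fill up with symbols of value \<open>0\<close>. The filling is what makes the argument work at all large
  times \<open>n\<close> with the same \<open>j\<close> and \<open>k\<close>: mixing, and not only transitivity.
\<close>

lemma cocycle_mixing_two_sided:
  "cocycle_mixing (time_shift :: (int \<times> bool \<Rightarrow> bool) \<Rightarrow> _) (step_at 0)"
  unfolding cocycle_mixing_def
proof (intro allI impI)
  fix U V :: "(int \<times> bool \<Rightarrow> bool) set" and W :: "real set"
  assume U: "open U" "U \<noteq> {}" and V: "open V" "V \<noteq> {}" and W: "open W" "W \<noteq> {}"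
  obtain u v where uv: "u \<in> U" "v \<in> V"
    using U V by blast
  obtain A where A: "finite A" "\<And>s'. (\<forall>k\<in>A. s' k = u k) \<Longrightarrow> s' \<in> U"
    using open_bool_functions_finite_support[OF U(1) uv(1)] by blast
  obtain B where B: "finite B" "\<And>s'. (\<forall>k\<in>B. s' k = v k) \<Longrightarrow> s' \<in> V"
    using open_bool_functions_finite_support[OF V(1) uv(2)] by blast
  obtain m :: nat where m: "\<And>i b. (i, b) \<in> A \<union> B \<Longrightarrow> \<bar>i\<bar> < int m"
  proof -
    have "finite ((\<lambda>p. nat \<bar>fst p\<bar>) ` (A \<union> B))"
      using A(1) B(1) by simp
    then obtain m where "\<And>x. x \<in> (\<lambda>p. nat \<bar>fst p\<bar>) ` (A \<union> B) \<Longrightarrow> x < m"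
      unfolding finite_nat_set_iff_bounded by blast
    from this[OF imageI] show thesis
      by (intro that[of m]) force
  qed
  \<comment> \<open>the contributions of the prescribed initial and final segments to the Birkhoff sum\<close>
  define \<alpha> where "\<alpha> = (\<Sum>k<m. step_at (int k) u)"
  define \<beta> where "\<beta> = (\<Sum>k<m. step_at (int k - int m) v)"
  have "open ((\<lambda>w. \<alpha> + \<beta> + w) -` W)"
    by (intro open_vimage W(1) continuous_intros)
  moreover have "(\<lambda>w. \<alpha> + \<beta> + w) -` W \<noteq> {}"
  proof -
    obtain w where "w \<in> W" using W(2) by blast
    then have "w - \<alpha> - \<beta> \<in> (\<lambda>w. \<alpha> + \<beta> + w) -` W" by simp
    then show ?thesis by blast
  qed
  ultimately obtain j k :: nat where jk: "\<alpha> + \<beta> + (real j - sqrt 2 * real k) \<in> W"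
    using nat_combinations_sqrt2_dense by blast
  show "\<exists>n0. \<forall>n\<ge>n0. \<exists>s\<in>U. (time_shift ^^ n) s \<in> V \<and> birkhoff_sum time_shift (step_at 0) n s \<in> W"
  proof (intro exI allI impI)
    fix n assume "m + j + k + m \<le> n"
    then obtain z where n: "n = m + j + k + z + m"
      by (metis add.assoc add.commute le_iff_add)
    define s where "s = (\<lambda>(i, b). if i < int m then u (i, b)
        else if i < int (m + j) then True
        else if i < int (m + j + k) then \<not> b
        else if i < int (m + j + k + z) then False
        else v (i - int n, b))"
    have "s \<in> U"
    proof (rule A(2), rule ballI)
      fix p assume "p \<in> A"
      then show "s p = u p"
        using m[of "fst p" "snd p"] by (auto simp: s_def case_prod_beta)
    qed
    moreover have "(time_shift ^^ n) s \<in> V"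
    proof (rule B(2), rule ballI)
      fix p assume "p \<in> B"
      then show "(time_shift ^^ n) s p = v p"
        using m[of "fst p" "snd p"] by (auto simp: s_def funpow_time_shift case_prod_beta n)
    qed
    moreover have "birkhoff_sum time_shift (step_at 0) n s = \<alpha> + \<beta> + (real j - sqrt 2 * real k)"
    proof -
      \<comment> \<open>the sum splits into the five blocks of \<open>s\<close>\<close>
      have "(\<Sum>i<m. step_at (int i) s) = \<alpha>"
        unfolding \<alpha>_def by (rule sum.cong) (auto simp: step_at_def s_def)
      moreover have "(\<Sum>i<j. step_at (int (m + i)) s) = real j"
        by (simp add: step_at_def s_def)
      moreover have "(\<Sum>i<k. step_at (int (m + j + i)) s) = - sqrt 2 * real k"
        by (simp add: step_at_def s_def)
      moreover have "(\<Sum>i<z. step_at (int (m + j + k + i)) s) = 0"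
        by (simp add: step_at_def s_def)
      moreover have "(\<Sum>i<m. step_at (int (m + j + k + z + i)) s) = \<beta>"
        unfolding \<beta>_def by (rule sum.cong) (auto simp: step_at_def s_def n)
      ultimately show ?thesis
        unfolding birkhoff_sum_time_shift n sum_lessThan_add by simp
    qed
    ultimately show "\<exists>s\<in>U. (time_shift ^^ n) s \<in> V \<and> birkhoff_sum time_shift (step_at 0) n s \<in> W"
      using jk by auto
  qed
qed

text \<open>
  Forgetting the negative times is a factor map from the two-sided onto the one-sided shift, and the
  cocycle does not look at negative times.
\<close>

lemma cocycle_mixing_one_sided:
  "cocycle_mixing (time_shift :: (nat \<times> bool \<Rightarrow> bool) \<Rightarrow> _) (step_at 0)"
proof (rule cocycle_mixing_factor)
  define \<rho> :: "(int \<times> bool \<Rightarrow> bool) \<Rightarrow> (nat \<times> bool \<Rightarrow> bool)" where "\<rho> s = (\<lambda>(i, b). s (int i, b))" for s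
  have "step_at 0 \<circ> \<rho> = step_at 0"
    by (simp add: fun_eq_iff \<rho>_def step_at_def)
  then show "cocycle_mixing time_shift (step_at 0 \<circ> \<rho>)"
    using cocycle_mixing_two_sided by simp
  show "continuous_on UNIV \<rho>"
    unfolding \<rho>_def
    by (intro continuous_on_coordinatewise_then_product) (auto simp: case_prod_beta continuous_on_coordinate)
  show "surj \<rho>"
  proof (rule surjI)
    show "\<rho> (\<lambda>(i, b). s (nat i, b)) = s" for s
      by (simp add: \<rho>_def fun_eq_iff)
  qed
  show "\<rho> (time_shift s) = time_shift (\<rho> s)" for s
    by (simp add: \<rho>_def time_shift_def fun_eq_iff add.commute)
qed

lemma bij_time_shift_int: "bij (time_shift :: (int \<times> bool \<Rightarrow> bool) \<Rightarrow> _)"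
  by (rule o_bij[of "\<lambda>s (i, b). s (i - 1, b)"]) (auto simp: time_shift_def fun_eq_iff)

lemma not_inj_time_shift_nat: "\<not> inj (time_shift :: (nat \<times> bool \<Rightarrow> bool) \<Rightarrow> _)"
proof
  assume inj: "inj (time_shift :: (nat \<times> bool \<Rightarrow> bool) \<Rightarrow> _)"
  have "time_shift (\<lambda>(i, b). i = (0::nat)) = time_shift (\<lambda>_. False)"
    by (simp add: time_shift_def fun_eq_iff)
  then have "(\<lambda>(i, b). i = (0::nat)) = (\<lambda>_::nat \<times> bool. False)"
    by (rule injD[OF inj])
  then show False
    by (metis case_prod_conv)
qed

section \<open>Chaos on the Cantor fan\<close>

lemma chaotic_skew_product_exists:
  fixes C :: "'a::metric_space set"
  assumes fan: "is_cantor_fan C"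
    and index: "infinite (UNIV :: ('i::semiring_1 \<times> bool) set)" "countable (UNIV :: ('i \<times> bool) set)"
    and mix: "cocycle_mixing (time_shift :: ('i \<times> bool \<Rightarrow> bool) \<Rightarrow> _) (step_at 0)"
  obtains \<pi> F where "fan_skew_product C \<pi> (time_shift :: ('i \<times> bool \<Rightarrow> bool) \<Rightarrow> _) (step_at 0) F"
    "dynamical_system C F" "mixing_system C F" "robinson_chaotic C F" "\<not> devaney_chaotic C F"
proof -
  obtain \<pi> :: "('i \<times> bool \<Rightarrow> bool) \<times> real \<Rightarrow> 'a" where "fan_chart \<pi> C"
    using fan index by (rule cantor_fan_has_chart)
  then obtain F where F: "fan_skew_product C \<pi> time_shift (step_at 0) F"
    using continuous_time_shift continuous_step_at by (rule fan_skew_product_exists)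
  interpret fan_skew_product C \<pi> time_shift "step_at 0" F
    by (rule F)
  have "step_at (0::'i) (\<lambda>_. True) \<noteq> 0"
    by (simp add: step_at_def)
  then have "\<not> devaney_chaotic C F"
    using birkhoff_sum_time_shift_eq_0 by (intro not_devaney_chaotic_fan_map)
  then show thesis
    using that[OF F] dynamical_system_fan_map mixing_fan_map[OF mix] robinson_chaotic_fan_map[OF mix]
    by blast
qed

theorem theorem5p22:
  fixes C :: "'a::metric_space set"
  assumes "is_cantor_fan C"
  shows "(\<exists>f. dynamical_system C f \<and> \<not> (\<exists>g. homeomorphism C C f g) \<and>
             mixing_system C f \<and> robinson_chaotic C f \<and> \<not> devaney_chaotic C f)
       \<and> (\<exists>h. dynamical_system C h \<and> (\<exists>g. homeomorphism C C h g) \<and>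
             mixing_system C h \<and> robinson_chaotic C h \<and> \<not> devaney_chaotic C h)"
proof
  have "infinite (UNIV :: (nat \<times> bool) set)"
    by (simp add: finite_prod)
  then obtain \<pi> f where "fan_skew_product C \<pi> (time_shift :: (nat \<times> bool \<Rightarrow> bool) \<Rightarrow> _) (step_at 0) f"
      "dynamical_system C f" "mixing_system C f" "robinson_chaotic C f" "\<not> devaney_chaotic C f"
    using chaotic_skew_product_exists[OF assms _ _ cocycle_mixing_one_sided] by auto
  then show "\<exists>f. dynamical_system C f \<and> \<not> (\<exists>g. homeomorphism C C f g) \<and>
      mixing_system C f \<and> robinson_chaotic C f \<and> \<not> devaney_chaotic C f"
    using fan_skew_product.not_homeomorphism_fan_map not_inj_time_shift_nat by blast
  have "infinite (UNIV :: (int \<times> bool) set)"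
    by (simp add: finite_prod)
  then obtain \<pi> h where "fan_skew_product C \<pi> (time_shift :: (int \<times> bool \<Rightarrow> bool) \<Rightarrow> _) (step_at 0) h"
      "dynamical_system C h" "mixing_system C h" "robinson_chaotic C h" "\<not> devaney_chaotic C h"
    using chaotic_skew_product_exists[OF assms _ _ cocycle_mixing_two_sided] by auto
  then show "\<exists>h. dynamical_system C h \<and> (\<exists>g. homeomorphism C C h g) \<and>
      mixing_system C h \<and> robinson_chaotic C h \<and> \<not> devaney_chaotic C h"
    using fan_skew_product.homeomorphism_fan_map bij_time_shift_int by blast
qed

end
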